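(* Let $\mu$ and $k$ be positive integers with $k\ge\mu$. If for every integer $l$ with $k+1\le l\le 2k-1$ there exists a $(\mu,k,l)$ Latin trade, then for every integer $m\ge k$ there exists a $(\mu,k,m)$ Latin trade.
   Context: A partial Latin square is a square array, some of whose cells are filled with symbols from a finite set and the others empty, such that each symbol occurs at most once in each row and at most once in each column. For a positive integer $\mu$, a $\mu$-way Latin trade is a tuple $(T_1,\dots,T_\mu)$ of partial Latin squares with exactly the same set of filled cells such that: every filled cell $(i,j)$ contains pairwise different entries in $T_1,\dots,T_\mu$; for each row $i$, the set of symbols in row $i$ is the same in all of $T_1,\dots,T_\mu$; and for each column $j$, the set of symbols in column $j$ is the same in all of $T_1,\dots,T_\mu$. For $\mu\le k\le m$, a $(\mu,k,m)$ Latin trade (also called a $\mu$-way $k$-homogeneous Latin trade) is a $\mu$-way Latin trade $(T_1,\dots,T_\mu)$ consisting of $m\times m$ arrays on a set of $m$ symbols such that in each $T_r$ every row has exactly $k$ filled cells, every column has exactly $k$ filled cells, and every symbol appears exactly $k$ times. *)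

theory Defs
  imports Main
begin

text \<open>
  An array is a function from (row, column) to an optional symbol; \<open>None\<close> marks an empty cell.
  Rows and columns of an array of order \<open>n\<close> are numbered \<open>0, \<dots>, n - 1\<close>, and all positions
  outside this range are required to be empty.
\<close>

type_synonym 's array = "nat \<Rightarrow> nat \<Rightarrow> 's option"

definition filled_cells :: "'s array \<Rightarrow> (nat \<times> nat) set" where
  "filled_cells L = {(i, j). L i j \<noteq> None}"

definition row_symbols :: "'s array \<Rightarrow> nat \<Rightarrow> 's set" where
  "row_symbols L i = {s. \<exists>j. L i j = Some s}"

definition col_symbols :: "'s array \<Rightarrow> nat \<Rightarrow> 's set" where
  "col_symbols L j = {s. \<exists>i. L i j = Some s}"

definition partial_latin_square :: "nat \<Rightarrow> 's set \<Rightarrow> 's array \<Rightarrow> bool" where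
  "partial_latin_square n S L \<longleftrightarrow>
     finite S \<and>
     filled_cells L \<subseteq> {..<n} \<times> {..<n} \<and>
     (\<forall>i j s. L i j = Some s \<longrightarrow> s \<in> S) \<and>
     (\<forall>i j j' s. L i j = Some s \<and> L i j' = Some s \<longrightarrow> j = j') \<and>
     (\<forall>i i' j s. L i j = Some s \<and> L i' j = Some s \<longrightarrow> i = i')"

text \<open>The tuple \<open>(T\<^sub>1, \<dots>, T\<^sub>\<mu>)\<close> is the list \<open>Ts\<close>, with \<open>T\<^sub>r = Ts ! (r - 1)\<close>.\<close>

definition latin_trade :: "nat \<Rightarrow> nat \<Rightarrow> 's set \<Rightarrow> 's array list \<Rightarrow> bool" where
  "latin_trade \<mu> n S Ts \<longleftrightarrow>
     0 < \<mu> \<and> length Ts = \<mu> \<and>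
     (\<forall>T\<in>set Ts. partial_latin_square n S T) \<and>
     (\<forall>T\<in>set Ts. \<forall>U\<in>set Ts. filled_cells T = filled_cells U) \<and>
     (\<forall>p<\<mu>. \<forall>q<\<mu>. p \<noteq> q \<longrightarrow>
        (\<forall>(i, j)\<in>filled_cells (Ts ! p). (Ts ! p) i j \<noteq> (Ts ! q) i j)) \<and>
     (\<forall>T\<in>set Ts. \<forall>U\<in>set Ts. \<forall>i<n. row_symbols T i = row_symbols U i) \<and>
     (\<forall>T\<in>set Ts. \<forall>U\<in>set Ts. \<forall>j<n. col_symbols T j = col_symbols U j)"

definition homogeneous_latin_trade ::
    "nat \<Rightarrow> nat \<Rightarrow> nat \<Rightarrow> 's set \<Rightarrow> 's array list \<Rightarrow> bool" where
  "homogeneous_latin_trade \<mu> k m S Ts \<longleftrightarrow>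
     \<mu> \<le> k \<and> k \<le> m \<and> card S = m \<and> latin_trade \<mu> m S Ts \<and>
     (\<forall>T\<in>set Ts.
        (\<forall>i<m. card {j. (i, j) \<in> filled_cells T} = k) \<and>
        (\<forall>j<m. card {i. (i, j) \<in> filled_cells T} = k) \<and>
        (\<forall>s\<in>S. card {(i, j). T i j = Some s} = k))"

text \<open>
  Symbols are drawn from \<open>nat\<close>; since only finitely many are used, this is no restriction
  on the existence of a trade.
\<close>

definition exists_latin_trade :: "nat \<Rightarrow> nat \<Rightarrow> nat \<Rightarrow> bool" where
  "exists_latin_trade \<mu> k m \<longleftrightarrow>
     (\<exists>(S :: nat set) Ts. homogeneous_latin_trade \<mu> k m S Ts)"

end

theory Submission
  imports Defs "HOL-Library.Nat_Bijection"
begin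

text \<open>
  Two trades with the same \<open>\<mu>\<close> and \<open>k\<close>, of orders \<open>m\<close> and \<open>n\<close>, can be placed as diagonal blocks on
  disjoint symbol sets. No row, column or symbol meets both blocks, so every condition on the
  result is a condition on one block, and the outcome is a \<open>(\<mu>, k, m + n)\<close> trade
  (\<open>homogeneous_block_diag\<close>). Hence the orders for which a trade exists are closed under addition.

  Order \<open>k\<close> is always available: the cyclic Latin square of order \<open>k\<close>, together with its
  translates by \<open>r < \<mu> \<le> k\<close> in the symbols, is a trade with all cells filled
  (\<open>homogeneous_cyclic\<close>). With the assumed orders this gives everything from \<open>k\<close> to \<open>2 k - 1\<close>, that is,
  one order in each residue class modulo \<open>k\<close>, and adding blocks of order \<open>k\<close> reaches every \<open>m \<ge> k\<close>.
\<close>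

section \<open>Trades as families of arrays\<close>

text \<open>
  The constructions below give the \<open>p\<close>-th array of a trade as a function of \<open>p\<close>, so the
  destruction and introduction rules speak of arrays by index throughout, also where the definition
  ranges over the set of list members.
\<close>

lemma homogeneous_latin_tradeD:
  assumes "homogeneous_latin_trade \<mu> k m S Ts"
  shows "0 < \<mu>" and "\<mu> \<le> k" and "k \<le> m" and "card S = m"
    and "\<And>p. p < \<mu> \<Longrightarrow> partial_latin_square m S (Ts ! p)"
    and "\<And>p q. p < \<mu> \<Longrightarrow> q < \<mu> \<Longrightarrow> filled_cells (Ts ! p) = filled_cells (Ts ! q)"
    and "\<And>p q i j. p < \<mu> \<Longrightarrow> q < \<mu> \<Longrightarrow> p \<noteq> q \<Longrightarrow> (i, j) \<in> filled_cells (Ts ! p) \<Longrightarrow>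
      (Ts ! p) i j \<noteq> (Ts ! q) i j"
    and "\<And>p q i. p < \<mu> \<Longrightarrow> q < \<mu> \<Longrightarrow> i < m \<Longrightarrow> row_symbols (Ts ! p) i = row_symbols (Ts ! q) i"
    and "\<And>p q j. p < \<mu> \<Longrightarrow> q < \<mu> \<Longrightarrow> j < m \<Longrightarrow> col_symbols (Ts ! p) j = col_symbols (Ts ! q) j"
    and "\<And>p i. p < \<mu> \<Longrightarrow> i < m \<Longrightarrow> card {j. (i, j) \<in> filled_cells (Ts ! p)} = k"
    and "\<And>p j. p < \<mu> \<Longrightarrow> j < m \<Longrightarrow> card {i. (i, j) \<in> filled_cells (Ts ! p)} = k"
    and "\<And>p s. p < \<mu> \<Longrightarrow> s \<in> S \<Longrightarrow> card {(i, j). (Ts ! p) i j = Some s} = k"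
  using assms nth_mem[of _ Ts]
  unfolding homogeneous_latin_trade_def latin_trade_def Ball_def split_paired_All prod.case
  by meson+

lemma homogeneous_latin_trade_mapI:
  assumes "0 < \<mu>" and "\<mu> \<le> k" and "k \<le> m" and "card S = m"
    and "\<And>p. p < \<mu> \<Longrightarrow> partial_latin_square m S (T p)"
    and "\<And>p q. p < \<mu> \<Longrightarrow> q < \<mu> \<Longrightarrow> filled_cells (T p) = filled_cells (T q)"
    and "\<And>p q i j. p < \<mu> \<Longrightarrow> q < \<mu> \<Longrightarrow> p \<noteq> q \<Longrightarrow> (i, j) \<in> filled_cells (T p) \<Longrightarrow>
      T p i j \<noteq> T q i j"
    and "\<And>p q i. p < \<mu> \<Longrightarrow> q < \<mu> \<Longrightarrow> i < m \<Longrightarrow> row_symbols (T p) i = row_symbols (T q) i"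
    and "\<And>p q j. p < \<mu> \<Longrightarrow> q < \<mu> \<Longrightarrow> j < m \<Longrightarrow> col_symbols (T p) j = col_symbols (T q) j"
    and "\<And>p i. p < \<mu> \<Longrightarrow> i < m \<Longrightarrow> card {j. (i, j) \<in> filled_cells (T p)} = k"
    and "\<And>p j. p < \<mu> \<Longrightarrow> j < m \<Longrightarrow> card {i. (i, j) \<in> filled_cells (T p)} = k"
    and "\<And>p s. p < \<mu> \<Longrightarrow> s \<in> S \<Longrightarrow> card {(i, j). T p i j = Some s} = k"
  shows "homogeneous_latin_trade \<mu> k m S (map T [0..<\<mu>])"
proof -
  have nth: "map T [0..<\<mu>] ! p = T p" if "p < \<mu>" for p
    using that by simp
  have set: "set (map T [0..<\<mu>]) = T ` {..<\<mu>}"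
    by (simp add: lessThan_atLeast0)
  show ?thesis
    unfolding homogeneous_latin_trade_def latin_trade_def set ball_simps lessThan_iff
    by (intro conjI allI impI ballI case_prodI2; hypsubst?;
        (simp only: nth length_map length_upt diff_zero lessThan_iff)?;
        rule assms; assumption)
qed

lemma partial_latin_square_empty_outside:
  assumes "partial_latin_square n S L" and "L i j = Some s"
  shows "i < n" and "j < n"
  using assms by (auto simp: partial_latin_square_def filled_cells_def)

section \<open>Relabelling the symbols\<close>

definition relabel :: "('s \<Rightarrow> 't) \<Rightarrow> 's array \<Rightarrow> 't array" where
  "relabel f L = (\<lambda>i j. map_option f (L i j))"

lemma filled_cells_relabel [simp]: "filled_cells (relabel f L) = filled_cells L"
  by (auto simp: filled_cells_def relabel_def)

lemma row_symbols_relabel: "row_symbols (relabel f L) i = f ` row_symbols L i"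
  by (auto simp: row_symbols_def relabel_def)

lemma col_symbols_relabel: "col_symbols (relabel f L) j = f ` col_symbols L j"
  by (auto simp: col_symbols_def relabel_def)

lemma partial_latin_square_relabel:
  assumes "inj f" and "partial_latin_square n S L"
  shows "partial_latin_square n (f ` S) (relabel f L)"
  using assms unfolding partial_latin_square_def filled_cells_relabel
  by (auto simp: relabel_def inj_eq[OF assms(1)]) blast+

lemma homogeneous_relabel:
  assumes f: "inj f" and T: "homogeneous_latin_trade \<mu> k m S Ts"
  shows "homogeneous_latin_trade \<mu> k m (f ` S) (map (\<lambda>p. relabel f (Ts ! p)) [0..<\<mu>])"
proof -
  note T' = homogeneous_latin_tradeD[OF T]
  have sym: "{(i, j). relabel f L i j = Some (f s)} = {(i, j). L i j = Some s}" for L s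
    by (auto simp: relabel_def inj_eq[OF f])
  have neq: "relabel f L i j = relabel f M i j \<longleftrightarrow> L i j = M i j" for L M i j
    by (simp add: relabel_def inj_eq[OF option.inj_map[OF f]])
  show ?thesis
  proof (rule homogeneous_latin_trade_mapI, unfold filled_cells_relabel row_symbols_relabel
      col_symbols_relabel neq)
    show "card (f ` S) = m"
      using T'(4) card_image[OF inj_on_subset[OF f subset_UNIV], of S] by simp
  next
    fix p s assume "p < \<mu>" "s \<in> f ` S"
    then obtain t where "s = f t" "card {(i, j). (Ts ! p) i j = Some t} = k"
      by (blast intro: T'(12))
    then show "card {(i, j). relabel f (Ts ! p) i j = Some s} = k"
      by (simp add: sym)
  next
    fix p assume "p < \<mu>"
    then show "partial_latin_square m (f ` S) (relabel f (Ts ! p))"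
      by (intro partial_latin_square_relabel[OF f] T'(5))
  qed (assumption | rule T' arg_cong[where f = "image f"])+
qed

section \<open>Diagonal blocks\<close>

text \<open>
  The sum type keeps the symbols of the two blocks apart, whatever the given symbol sets are.
\<close>

definition block_diag :: "nat \<Rightarrow> 'a array \<Rightarrow> 'b array \<Rightarrow> ('a + 'b) array" where
  "block_diag m A B = (\<lambda>i j.
     if i < m \<and> j < m then map_option Inl (A i j)
     else if m \<le> i \<and> m \<le> j then map_option Inr (B (i - m) (j - m))
     else None)"

lemma block_diag_Inl_iff:
  assumes "partial_latin_square m S A"
  shows "block_diag m A B i j = Some (Inl s) \<longleftrightarrow> A i j = Some s"
  using partial_latin_square_empty_outside[OF assms, of i j]
  by (auto simp: block_diag_def)

lemma block_diag_Inr_iff: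
  "block_diag m A B i j = Some (Inr s) \<longleftrightarrow> m \<le> i \<and> m \<le> j \<and> B (i - m) (j - m) = Some s"
  by (auto simp: block_diag_def)

lemma filled_cells_block_diag:
  "(i, j) \<in> filled_cells (block_diag m A B) \<longleftrightarrow>
    (if i < m \<and> j < m then (i, j) \<in> filled_cells A
     else m \<le> i \<and> m \<le> j \<and> (i - m, j - m) \<in> filled_cells B)"
  by (auto simp: filled_cells_def block_diag_def)

lemma row_symbols_block_diag:
  assumes "partial_latin_square m S A"
  shows "row_symbols (block_diag m A B) i =
    (if i < m then Inl ` row_symbols A i else Inr ` row_symbols B (i - m))"
proof (cases "i < m")
  case True
  then show ?thesis
    using partial_latin_square_empty_outside[OF assms, of i]
    by (fastforce simp: row_symbols_def block_diag_def split: if_splits)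
next
  case False
  have "x \<in> row_symbols (block_diag m A B) i" if x: "x \<in> Inr ` row_symbols B (i - m)" for x
  proof -
    obtain s j where "x = Inr s" and "B (i - m) j = Some s"
      using x by (auto simp: row_symbols_def)
    then have "block_diag m A B i (j + m) = Some x"
      using False by (simp add: block_diag_def)
    then show ?thesis
      by (auto simp: row_symbols_def)
  qed
  moreover have "x \<in> Inr ` row_symbols B (i - m)" if "x \<in> row_symbols (block_diag m A B) i" for x
    using that False by (auto simp: row_symbols_def block_diag_def split: if_splits)
  ultimately show ?thesis
    using False by auto
qed

lemma col_symbols_block_diag:
  assumes "partial_latin_square m S A"
  shows "col_symbols (block_diag m A B) j =
    (if j < m then Inl ` col_symbols A j else Inr ` col_symbols B (j - m))"
proof (cases "j < m")
  case True
  then show ?thesis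
    using partial_latin_square_empty_outside[OF assms, of _ j]
    by (fastforce simp: col_symbols_def block_diag_def split: if_splits)
next
  case False
  have "x \<in> col_symbols (block_diag m A B) j" if x: "x \<in> Inr ` col_symbols B (j - m)" for x
  proof -
    obtain s i where "x = Inr s" and "B i (j - m) = Some s"
      using x by (auto simp: col_symbols_def)
    then have "block_diag m A B (i + m) j = Some x"
      using False by (simp add: block_diag_def)
    then show ?thesis
      by (auto simp: col_symbols_def)
  qed
  moreover have "x \<in> Inr ` col_symbols B (j - m)" if "x \<in> col_symbols (block_diag m A B) j" for x
    using that False by (auto simp: col_symbols_def block_diag_def split: if_splits)
  ultimately show ?thesis
    using False by auto
qed

lemma partial_latin_square_block_diag:
  assumes A: "partial_latin_square m S A" and B: "partial_latin_square n S' B"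
  shows "partial_latin_square (m + n) (S <+> S') (block_diag m A B)"
  unfolding partial_latin_square_def
proof (intro conjI allI impI)
  show "finite (S <+> S')"
    using A B by (simp add: partial_latin_square_def)
  have "filled_cells A \<subseteq> {..<m} \<times> {..<m}" "filled_cells B \<subseteq> {..<n} \<times> {..<n}"
    using A B by (simp_all add: partial_latin_square_def)
  then show "filled_cells (block_diag m A B) \<subseteq> {..<m + n} \<times> {..<m + n}"
    by (fastforce simp: filled_cells_block_diag split: if_splits)
next
  fix i j s assume "block_diag m A B i j = Some s"
  then show "s \<in> S <+> S'"
    using A B by (cases s)
      (auto simp: block_diag_Inl_iff[OF A] block_diag_Inr_iff partial_latin_square_def)
next
  fix i j j' s assume *: "block_diag m A B i j = Some s \<and> block_diag m A B i j' = Some s"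
  show "j = j'"
  proof (cases s)
    case (Inl a)
    then show ?thesis
      using * A unfolding Inl block_diag_Inl_iff[OF A] partial_latin_square_def by blast
  next
    case (Inr b)
    then have "m \<le> j" "m \<le> j'" "j - m = j' - m"
      using * B unfolding Inr block_diag_Inr_iff partial_latin_square_def by blast+
    then show ?thesis by simp
  qed
next
  fix i i' j s assume *: "block_diag m A B i j = Some s \<and> block_diag m A B i' j = Some s"
  show "i = i'"
  proof (cases s)
    case (Inl a)
    then show ?thesis
      using * A unfolding Inl block_diag_Inl_iff[OF A] partial_latin_square_def by blast
  next
    case (Inr b)
    then have "m \<le> i" "m \<le> i'" "i - m = i' - m"
      using * B unfolding Inr block_diag_Inr_iff partial_latin_square_def by blast+
    then show ?thesis by simp
  qed
qed

lemma card_shift: "card {x. m \<le> x \<and> P (x - m)} = card {x::nat. P x}"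
proof -
  have "bij_betw (\<lambda>x. x - m) {x. m \<le> x \<and> P (x - m)} {x. P x}"
    by (rule bij_betw_byWitness[where f' = "\<lambda>x. x + m"]) auto
  then show ?thesis
    by (rule bij_betw_same_card)
qed

lemma card_row_block_diag:
  assumes A: "partial_latin_square m S A"
  shows "card {j. (i, j) \<in> filled_cells (block_diag m A B)} =
    (if i < m then card {j. (i, j) \<in> filled_cells A}
     else card {j. (i - m, j) \<in> filled_cells B})"
proof (cases "i < m")
  case True
  have "(i, j) \<in> filled_cells A \<Longrightarrow> j < m" for j
    using A by (auto simp: partial_latin_square_def)
  then have "{j. (i, j) \<in> filled_cells (block_diag m A B)} = {j. (i, j) \<in> filled_cells A}"
    using True by (auto simp: filled_cells_block_diag)
  then show ?thesis
    using True by simp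
next
  case False
  then have "{j. (i, j) \<in> filled_cells (block_diag m A B)} =
      {j. m \<le> j \<and> (i - m, j - m) \<in> filled_cells B}"
    by (simp add: filled_cells_block_diag)
  then show ?thesis
    using False card_shift[of m "\<lambda>j. (i - m, j) \<in> filled_cells B"] by simp
qed

lemma card_col_block_diag:
  assumes A: "partial_latin_square m S A"
  shows "card {i. (i, j) \<in> filled_cells (block_diag m A B)} =
    (if j < m then card {i. (i, j) \<in> filled_cells A}
     else card {i. (i, j - m) \<in> filled_cells B})"
proof (cases "j < m")
  case True
  have "(i, j) \<in> filled_cells A \<Longrightarrow> i < m" for i
    using A by (auto simp: partial_latin_square_def)
  then have "{i. (i, j) \<in> filled_cells (block_diag m A B)} = {i. (i, j) \<in> filled_cells A}"
    using True by (auto simp: filled_cells_block_diag)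
  then show ?thesis
    using True by simp
next
  case False
  then have "{i. (i, j) \<in> filled_cells (block_diag m A B)} =
      {i. m \<le> i \<and> (i - m, j - m) \<in> filled_cells B}"
    by (simp add: filled_cells_block_diag)
  then show ?thesis
    using False card_shift[of m "\<lambda>i. (i, j - m) \<in> filled_cells B"] by simp
qed

lemma card_Inr_block_diag:
  "card {(i, j). block_diag m A B i j = Some (Inr s)} = card {(i, j). B i j = Some s}"
proof -
  let ?up = "\<lambda>(i, j). (i + m, j + m)" and ?down = "\<lambda>(i, j). (i - m, j - m)"
  let ?X = "{(i, j). block_diag m A B i j = Some (Inr s)}" and ?Y = "{(i, j). B i j = Some s}"
  have "bij_betw ?down ?X ?Y"
    by (rule bij_betw_byWitness[where f' = ?up]) (auto simp: block_diag_Inr_iff)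
  then show "card ?X = card ?Y" by (rule bij_betw_same_card)
qed

theorem homogeneous_block_diag:
  assumes T: "homogeneous_latin_trade \<mu> k m S Ts"
    and U: "homogeneous_latin_trade \<mu> k n S' Us"
  shows "homogeneous_latin_trade \<mu> k (m + n) (S <+> S')
    (map (\<lambda>p. block_diag m (Ts ! p) (Us ! p)) [0..<\<mu>])"
proof -
  note T' = homogeneous_latin_tradeD[OF T]
  note U' = homogeneous_latin_tradeD[OF U]
  let ?W = "\<lambda>p. block_diag m (Ts ! p) (Us ! p)"
  have pT: "partial_latin_square m S (Ts ! p)" if "p < \<mu>" for p
    by (intro T' that)
  have pU: "partial_latin_square n S' (Us ! p)" if "p < \<mu>" for p
    by (intro U' that)
  have fin: "finite S" "finite S'"
    using pT[OF T'(1)] pU[OF T'(1)] by (simp_all add: partial_latin_square_def)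
  have filled: "filled_cells (?W p) = filled_cells (?W q)" if "p < \<mu>" "q < \<mu>" for p q
  proof -
    have "filled_cells (Ts ! p) = filled_cells (Ts ! q)"
      "filled_cells (Us ! p) = filled_cells (Us ! q)"
      by (intro T' U' that)+
    then show ?thesis
      by (simp add: set_eq_iff split_paired_all filled_cells_block_diag)
  qed
  have neq: "?W p i j \<noteq> ?W q i j"
    if pq: "p < \<mu>" "q < \<mu>" "p \<noteq> q" and ij: "(i, j) \<in> filled_cells (?W p)" for p q i j
  proof -
    have "(Ts ! q) i' j' \<noteq> Some s" if "(Ts ! p) i' j' = Some s" for i' j' s
      using T'(7)[OF pq, of i' j'] that by (auto simp: filled_cells_def)
    moreover have "(Us ! q) i' j' \<noteq> Some s" if "(Us ! p) i' j' = Some s" for i' j' s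
      using U'(7)[OF pq, of i' j'] that by (auto simp: filled_cells_def)
    moreover obtain s where s: "?W p i j = Some s"
      using ij by (auto simp: filled_cells_def)
    ultimately have "?W q i j \<noteq> Some s"
      using pq by (cases s) (auto simp: block_diag_Inl_iff[OF pT] block_diag_Inr_iff)
    then show ?thesis
      using s by simp
  qed
  have rows: "row_symbols (?W p) i = row_symbols (?W q) i"
    if "p < \<mu>" "q < \<mu>" "i < m + n" for p q i
  proof (cases "i < m")
    case True
    then have "row_symbols (Ts ! p) i = row_symbols (Ts ! q) i" using that by (intro T')
    then show ?thesis using that True by (simp add: row_symbols_block_diag[OF pT])
  next
    case False
    then have "i - m < n" using that by simp
    then have "row_symbols (Us ! p) (i - m) = row_symbols (Us ! q) (i - m)"
      using that by (intro U')
    then show ?thesis using that False by (simp add: row_symbols_block_diag[OF pT])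
  qed
  have cols: "col_symbols (?W p) j = col_symbols (?W q) j"
    if "p < \<mu>" "q < \<mu>" "j < m + n" for p q j
  proof (cases "j < m")
    case True
    then have "col_symbols (Ts ! p) j = col_symbols (Ts ! q) j" using that by (intro T')
    then show ?thesis using that True by (simp add: col_symbols_block_diag[OF pT])
  next
    case False
    then have "j - m < n" using that by simp
    then have "col_symbols (Us ! p) (j - m) = col_symbols (Us ! q) (j - m)"
      using that by (intro U')
    then show ?thesis using that False by (simp add: col_symbols_block_diag[OF pT])
  qed
  have card_rows: "card {j. (i, j) \<in> filled_cells (?W p)} = k" if "p < \<mu>" "i < m + n" for p i
  proof (cases "i < m")
    case True
    then have "card {j. (i, j) \<in> filled_cells (Ts ! p)} = k" using that by (intro T')
    then show ?thesis using that True by (simp add: card_row_block_diag[OF pT])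
  next
    case False
    then have "i - m < n" using that by simp
    then have "card {j. (i - m, j) \<in> filled_cells (Us ! p)} = k" using that by (intro U')
    then show ?thesis using that False by (simp add: card_row_block_diag[OF pT])
  qed
  have card_cols: "card {i. (i, j) \<in> filled_cells (?W p)} = k" if "p < \<mu>" "j < m + n" for p j
  proof (cases "j < m")
    case True
    then have "card {i. (i, j) \<in> filled_cells (Ts ! p)} = k" using that by (intro T')
    then show ?thesis using that True by (simp add: card_col_block_diag[OF pT])
  next
    case False
    then have "j - m < n" using that by simp
    then have "card {i. (i, j - m) \<in> filled_cells (Us ! p)} = k" using that by (intro U')
    then show ?thesis using that False by (simp add: card_col_block_diag[OF pT])
  qed
  have card_syms: "card {(i, j). ?W p i j = Some s} = k" if "p < \<mu>" "s \<in> S <+> S'" for p s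
    using that(2)
  proof (rule PlusE)
    fix a assume 1: "s = Inl a" "a \<in> S"
    then have "card {(i, j). (Ts ! p) i j = Some a} = k" using that by (intro T')
    then show ?thesis using that 1 by (simp add: block_diag_Inl_iff[OF pT])
  next
    fix b assume 2: "s = Inr b" "b \<in> S'"
    then have "card {(i, j). (Us ! p) i j = Some b} = k" using that by (intro U')
    then show ?thesis using 2 by (simp add: card_Inr_block_diag)
  qed
  have card: "card (S <+> S') = m + n"
    using card_Plus[OF fin] T'(4) U'(4) by simp
  have "0 < \<mu>" "\<mu> \<le> k" "k \<le> m + n"
    using T'(1-3) by auto
  then show ?thesis
    using card partial_latin_square_block_diag[OF pT pU] filled neq rows cols
      card_rows card_cols card_syms
    by (rule homogeneous_latin_trade_mapI)
qed

lemma exists_latin_trade_add: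
  assumes "exists_latin_trade \<mu> k m" and "exists_latin_trade \<mu> k n"
  shows "exists_latin_trade \<mu> k (m + n)"
proof -
  obtain S S' :: "nat set" and Ts Us
    where "homogeneous_latin_trade \<mu> k m S Ts" "homogeneous_latin_trade \<mu> k n S' Us"
    using assms by (auto simp: exists_latin_trade_def)
  then have "homogeneous_latin_trade \<mu> k (m + n) (S <+> S')
      (map (\<lambda>p. block_diag m (Ts ! p) (Us ! p)) [0..<\<mu>])"
    by (rule homogeneous_block_diag)
  \<comment> \<open>Existence is stated for symbols in \<open>nat\<close>, so the tagged symbols are encoded back.\<close>
  from homogeneous_relabel[OF inj_sum_encode[of UNIV] this] show ?thesis
    unfolding exists_latin_trade_def by blast
qed

section \<open>Translates of the cyclic Latin square\<close>

definition cyclic_square :: "nat \<Rightarrow> nat \<Rightarrow> nat array" where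
  "cyclic_square k r = (\<lambda>i j. if i < k \<and> j < k then Some ((i + j + r) mod k) else None)"

lemma add_mod_cancel_less:
  fixes c k :: nat
  assumes "(c + x) mod k = (c + y) mod k" and "x < k" and "y < k"
  shows "x = y"
  using assms
proof (induction x y rule: linorder_wlog)
  case (le x y)
  then have "k dvd y - x"
    using mod_eq_dvd_iff_nat[of "c + x" "c + y" k] by simp
  with le show ?case
    using nat_dvd_not_less[of "y - x" k] by fastforce
qed simp

lemma image_add_mod: "(\<lambda>x. (c + x) mod k) ` {..<k} = {..<(k::nat)}"
  by (rule endo_inj_surj) (auto intro!: inj_onI dest: add_mod_cancel_less)

lemma cyclic_square_commute: "cyclic_square k r i j = cyclic_square k r j i"
  by (simp add: cyclic_square_def add.commute)

lemma filled_cells_cyclic_square: "filled_cells (cyclic_square k r) = {..<k} \<times> {..<k}"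
  by (auto simp: filled_cells_def cyclic_square_def)

lemma row_symbols_cyclic_square:
  assumes "i < k"
  shows "row_symbols (cyclic_square k r) i = {..<k}"
proof -
  have "row_symbols (cyclic_square k r) i = (\<lambda>j. (i + r + j) mod k) ` {..<k}"
    using assms by (auto simp: row_symbols_def cyclic_square_def image_iff ac_simps)
  then show ?thesis
    by (simp add: image_add_mod)
qed

lemma col_symbols_cyclic_square:
  "j < k \<Longrightarrow> col_symbols (cyclic_square k r) j = {..<k}"
  using row_symbols_cyclic_square[of j k r]
  by (simp add: col_symbols_def row_symbols_def cyclic_square_commute[of k r j])

lemma cyclic_square_inj:
  assumes "cyclic_square k r i j = Some s" and "cyclic_square k r i j' = Some s"
  shows "j = j'"
  using assms add_mod_cancel_less[of "i + r" j k j']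
  by (auto simp: cyclic_square_def ac_simps split: if_splits)

lemma partial_latin_square_cyclic: "partial_latin_square k {..<k} (cyclic_square k r)"
  unfolding partial_latin_square_def filled_cells_cyclic_square
proof (intro conjI allI impI; (elim conjE)?)
  fix i j s assume "cyclic_square k r i j = Some s"
  then show "s \<in> {..<k}"
    by (auto simp: cyclic_square_def split: if_splits)
next
  fix i i' j s assume "cyclic_square k r i j = Some s" "cyclic_square k r i' j = Some s"
  then show "i = i'"
    unfolding cyclic_square_commute[of k r _ j] by (rule cyclic_square_inj)
qed (simp_all add: cyclic_square_inj)

text \<open>
  A symbol occurs exactly once in each of the \<open>k\<close> rows, so its occurrences are counted by their rows.
\<close>

lemma card_symbol_cyclic_square:
  assumes "s < k"
  shows "card {(i, j). cyclic_square k r i j = Some s} = k"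
proof -
  have "bij_betw fst {(i, j). cyclic_square k r i j = Some s} {..<k}"
    unfolding bij_betw_def
  proof (intro conjI subset_antisym subsetI)
    show "inj_on fst {(i, j). cyclic_square k r i j = Some s}"
      by (auto simp: inj_on_def dest: cyclic_square_inj)
  next
    fix i assume "i \<in> {..<k}"
    then have "s \<in> row_symbols (cyclic_square k r) i"
      using assms by (simp add: row_symbols_cyclic_square)
    then show "i \<in> fst ` {(i, j). cyclic_square k r i j = Some s}"
      by (force simp: row_symbols_def)
  qed (auto simp: cyclic_square_def split: if_splits)
  then show ?thesis
    by (auto dest: bij_betw_same_card)
qed

text \<open>
  Two translates of the cyclic square by distinct amounts below \<open>k\<close> disagree in every filled cell; this
  is where \<open>\<mu> \<le> k\<close> is needed.
\<close>

lemma homogeneous_cyclic: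
  assumes "0 < \<mu>" and "\<mu> \<le> k"
  shows "homogeneous_latin_trade \<mu> k k {..<k} (map (cyclic_square k) [0..<\<mu>])"
proof -
  have "cyclic_square k p i j \<noteq> cyclic_square k q i j"
    if "p < \<mu>" "q < \<mu>" "p \<noteq> q" "i < k" "j < k" for p q i j
    using that assms add_mod_cancel_less[of "i + j" p k q] by (auto simp: cyclic_square_def)
  then show ?thesis
    using assms by (intro homogeneous_latin_trade_mapI)
      (simp_all add: partial_latin_square_cyclic filled_cells_cyclic_square
        row_symbols_cyclic_square col_symbols_cyclic_square card_symbol_cyclic_square)
qed

section \<open>All orders from k on\<close>

theorem theorem8:
  fixes \<mu> k :: nat
  assumes "0 < \<mu>" and "0 < k" and "\<mu> \<le> k"
    and "\<And>l. k + 1 \<le> l \<Longrightarrow> l \<le> 2 * k - 1 \<Longrightarrow> exists_latin_trade \<mu> k l"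
  shows "\<forall>m\<ge>k. exists_latin_trade \<mu> k m"
proof (intro allI impI)
  have base: "exists_latin_trade \<mu> k k"
    using homogeneous_cyclic[OF assms(1,3)] unfolding exists_latin_trade_def by blast
  fix m assume "k \<le> m"
  then show "exists_latin_trade \<mu> k m"
  proof (induction m rule: less_induct)
    case (less m)
    consider "m = k" | "k + 1 \<le> m" "m \<le> 2 * k - 1" | "2 * k \<le> m"
      using less.prems by linarith
    then show ?case
    proof cases
      case 3
      then have "exists_latin_trade \<mu> k (k + (m - k))"
        using assms(2) less by (intro exists_latin_trade_add base less.IH) auto
      then show ?thesis
        using less.prems by simp
    qed (use base assms(4) in auto)
  qed
qed

end
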